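(* For any prime power $q\ge 3$, there exists a $q$-ary Singleton-optimal locally repairable code (with disjoint repair groups) with length \[ n=3\left\lceil\frac{7+\sqrt{72q^2+121}}{18}\right\rceil, \] minimum distance $7$ and locality $2$.
   Context: Codes are linear: an $[n,k,d]_q$ code $C$ is a $k$-dimensional subspace of $\mathbb{F}_q^n$ with minimum Hamming distance $d$; $C^\perp$ is its dual code. $C$ is a locally repairable code (LRC) with locality $r$ if for every coordinate $i\in[n]=\{1,\dots,n\}$ there is a codeword $\bm h\in C^\perp$ with $i\in\mathrm{supp}(\bm h)$ and Hamming weight at most $r+1$. When $(r+1)\mid n$, $C$ has disjoint repair groups if there are $n/(r+1)$ codewords of $C^\perp$, each of Hamming weight exactly $r+1$, with pairwise disjoint supports (so the supports partition $[n]$). Convention on optimality: when $(r+1)\mid n$, an LRC is called Singleton-optimal if $n-k=\frac{n}{r+1}+d-2-\left\lfloor\frac{d-2}{r+1}\right\rfloor$. (For $d=7$, $r=2$ the usual Singleton-type bound $d\le n-k-\lceil k/r\rceil+2$ cannot be met with equality, and this equation is used instead.) Thus for $d=7$, $r=2$, $3\mid n$, Singleton-optimal means $n-k=n/3+4$.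
   Formalization: For q = 3 the formula gives n = 6 and optimality forces dimension 0, so the code is the zero code, whose minimum distance is undefined; the formal statement takes the minimum distance of the zero code of length n to be n + 1 (here 7). For q ≥ 4 this convention plays no role. *)

theory Defs
  imports
    Complex_Main
    "HOL-Library.Disjoint_Sets"
    "HOL-Number_Theory.Prime_Powers"
    "Jordan_Normal_Form.VS_Connect"
begin

text \<open>Codes over a finite field \<open>'a\<close> are sets of vectors in \<open>carrier_vec n\<close>;
  coordinates are numbered \<open>0, \<dots>, n - 1\<close>.\<close>

definition supp :: "'a::zero vec \<Rightarrow> nat set" where
  "supp v = {i. i < dim_vec v \<and> v $ i \<noteq> 0}"

definition hamming_weight :: "'a::zero vec \<Rightarrow> nat" where
  "hamming_weight v = card (supp v)"

definition hamming_dist :: "'a vec \<Rightarrow> 'a vec \<Rightarrow> nat" where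
  "hamming_dist u v = card {i. i < dim_vec u \<and> u $ i \<noteq> v $ i}"

definition linear_code :: "nat \<Rightarrow> nat \<Rightarrow> 'a::field vec set \<Rightarrow> bool" where
  "linear_code n k C \<longleftrightarrow>
     VectorSpace.subspace class_ring C (module_vec TYPE('a) n) \<and>
     vectorspace.dim class_ring ((module_vec TYPE('a) n)\<lparr>carrier := C\<rparr>) = k"

text \<open>The zero code has no two distinct codewords. By the usual convention its minimum distance
  is \<open>n + 1\<close>, so that it is an \<open>[n, 0, n + 1]\<close> code. No other code of length \<open>n\<close> has
  minimum distance exceeding \<open>n\<close>.\<close>

definition min_distance :: "nat \<Rightarrow> 'a::zero vec set \<Rightarrow> nat" where
  "min_distance n C =
     (if C = {0\<^sub>v n} then n + 1
      else Min {hamming_dist u v | u v. u \<in> C \<and> v \<in> C \<and> u \<noteq> v})"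

definition dual_code :: "nat \<Rightarrow> 'a::field vec set \<Rightarrow> 'a vec set" where
  "dual_code n C = {h \<in> carrier_vec n. \<forall>c\<in>C. h \<bullet> c = 0}"

definition has_locality :: "nat \<Rightarrow> nat \<Rightarrow> 'a::field vec set \<Rightarrow> bool" where
  "has_locality n r C \<longleftrightarrow>
     (\<forall>i<n. \<exists>h\<in>dual_code n C. i \<in> supp h \<and> hamming_weight h \<le> r + 1)"

definition disjoint_repair_groups :: "nat \<Rightarrow> nat \<Rightarrow> 'a::field vec set \<Rightarrow> bool" where
  "disjoint_repair_groups n r C \<longleftrightarrow>
     (r + 1) dvd n \<and>
     (\<exists>H \<subseteq> dual_code n C.
        finite H \<and> card H = n div (r + 1) \<and>
        (\<forall>h\<in>H. hamming_weight h = r + 1) \<and>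
        disjoint_family_on supp H)"

text \<open>For \<open>d = 7\<close> and \<open>r = 2\<close> the bound \<open>d \<le> n - k - \<lceil>k / r\<rceil> + 2\<close> is never attained when
  \<open>r + 1\<close> divides \<open>n\<close>; optimality is therefore expressed by the following equation in \<open>n - k\<close>.\<close>

definition singleton_optimal :: "nat \<Rightarrow> nat \<Rightarrow> nat \<Rightarrow> nat \<Rightarrow> bool" where
  "singleton_optimal n k d r \<longleftrightarrow>
     (r + 1) dvd n \<and>
     int n - int k = int (n div (r + 1)) + int d - 2 - \<lfloor>(real d - 2) / (real r + 1)\<rfloor>"

end

theory Submission
  imports Defs "HOL-Library.Product_Plus"
begin

text \<open>Write the length as \<open>n = 3 m\<close>. A code with \<open>m\<close> repair groups of size 3 and four
  further parity checks is the same as \<open>m\<close> lines in \<open>PG(3, q)\<close> with three special points on each: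
  a codeword restricted to a group gives a vector on the corresponding line, and words of weight 2
  in the group give the special points. The minimum distance is at least 7 iff the lines are
  pairwise skew and no three special points of distinct lines are collinear.

  The lines are taken greedily from the regular spread of \<open>q\<^sup>2 + 1\<close> lines, that is, the
  \<open>K\<close>-lines of \<open>K \<times> K\<close> for the field \<open>K\<close> of order \<open>q\<^sup>2\<close>. The \<open>9 m (m - 1) / 2\<close> lines joining
  special points of \<open>m\<close> chosen lines have \<open>q - 1\<close> further points each, and a spread line is lost
  only when \<open>q - 1\<close> of its points are covered. So another line exists while
  \<open>9 m (m - 1) / 2 < q\<^sup>2 + 1 - m\<close>.

  The minimum distance could still be 8. For \<open>q \<ge> 4\<close> the first three lines are therefore chosen
  so that a line joining special points of the first two meets the third, which yields a word of
  weight 7. For \<open>q = 3\<close> one gets \<open>n = 6\<close> and the zero code, whose minimum distance is 7 by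
  convention.\<close>

section \<open>The quadratic extension field\<close>

text \<open>On a finite field a map that is not injective misses some value \<open>c\<close>. Here
  \<open>0\<close> and \<open>- 1\<close> have the same image, so \<open>t * t + t - c\<close> has
  no root for such a \<open>c\<close>.\<close>

lemma exists_irreducible_quadratic:
  "\<exists>c::'a::{field,finite}. \<forall>t. t * t + t \<noteq> c"
proof -
  let ?f = "\<lambda>t::'a. t * t + t"
  have "?f 0 = ?f (- 1)" by simp
  then have "\<not> inj ?f"
    unfolding inj_def by (metis neg_equal_0_iff_equal one_neq_zero)
  then have "\<not> surj ?f"
    using finite_UNIV_surj_inj[of ?f] by auto
  then show ?thesis unfolding surj_def by metis
qed

definition quad_const :: "'a::{field,finite}" where
  "quad_const = (SOME c. \<forall>t. t * t + t \<noteq> c)"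

lemma quad_const: "t * t + t \<noteq> (quad_const :: 'a::{field,finite})"
  using someI_ex[OF exists_irreducible_quadratic] unfolding quad_const_def by blast

text \<open>The element \<open>Quad a b\<close> stands for \<open>a + b \<theta>\<close> where \<open>\<theta>\<^sup>2 + \<theta> = quad_const\<close>. The polynomial
  \<open>t\<^sup>2 + t - c\<close> also works in characteristic 2, where adjoining a square root would not.\<close>

datatype 'a quad = Quad (qre: 'a) (qim: 'a)

instance quad :: (finite) finite
proof
  have "(UNIV :: 'a quad set) = range (\<lambda>(a, b). Quad a b)"
    by (auto simp: image_iff) (metis quad.exhaust)
  then show "finite (UNIV :: 'a quad set)"
    by (metis finite finite_imageI)
qed

instantiation quad :: ("{field,finite}") field
begin

definition zero_quad where "0 = Quad 0 0"
definition one_quad where "1 = Quad 1 0"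
definition plus_quad where "z + w = Quad (qre z + qre w) (qim z + qim w)"
definition minus_quad where "z - w = Quad (qre z - qre w) (qim z - qim w)"
definition uminus_quad where "- z = Quad (- qre z) (- qim z)"
definition times_quad where
  "z * w = Quad (qre z * qre w + quad_const * (qim z * qim w))
                (qre z * qim w + qim z * qre w - qim z * qim w)"
text \<open>The field norm, that is, the product of \<open>z\<close> with its conjugate.\<close>

definition quad_norm :: "'a quad \<Rightarrow> 'a" where
  "quad_norm z = qre z * qre z - qre z * qim z - quad_const * (qim z * qim z)"
text \<open>The conjugate of \<open>\<theta>\<close> is \<open>- 1 - \<theta>\<close>.\<close>
definition inverse_quad where
  "inverse z = Quad ((qre z - qim z) / quad_norm z) (- qim z / quad_norm z)"
definition divide_quad where "z div w = z * inverse (w :: 'a quad)"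

text \<open>If \<open>qim z\<close> were nonzero, dividing the norm by its square would make
  \<open>t = - qre z / qim z\<close> a root of the irreducible quadratic.\<close>

lemma quad_norm_eq_0: "quad_norm z = 0 \<Longrightarrow> z = 0"
proof -
  assume *: "quad_norm z = 0"
  have "qim z = 0"
  proof (rule ccontr)
    assume n: "qim z \<noteq> 0"
    define t where "t = - qre z / qim z"
    have r: "qre z = - t * qim z" using n by (simp add: t_def)
    have "(t * t + t - quad_const) * (qim z * qim z) = 0"
      using * unfolding quad_norm_def r by (simp add: algebra_simps)
    with n quad_const[of t] show False by simp
  qed
  with * show "z = 0" by (cases z) (simp add: quad_norm_def zero_quad_def)
qed

instance
proof
  fix x y z :: "'a quad"
  show "x * y * z = x * (y * z)"
    by (simp add: times_quad_def algebra_simps)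
  show "x * y = y * x" by (simp add: times_quad_def algebra_simps)
  show "1 * x = x" by (simp add: times_quad_def one_quad_def)
  show "x + y + z = x + (y + z)" by (simp add: plus_quad_def algebra_simps)
  show "x + y = y + x" by (simp add: plus_quad_def algebra_simps)
  show "0 + x = x" by (simp add: plus_quad_def zero_quad_def)
  show "- x + x = 0" by (simp add: plus_quad_def uminus_quad_def zero_quad_def)
  show "x - y = x + - y" by (simp add: plus_quad_def uminus_quad_def minus_quad_def)
  show "(x + y) * z = x * z + y * z"
    by (simp add: plus_quad_def times_quad_def algebra_simps)
  show "(0::'a quad) \<noteq> 1" by (simp add: zero_quad_def one_quad_def)
  show "inverse (0::'a quad) = 0" by (simp add: inverse_quad_def zero_quad_def)
  show "x div y = x * inverse y" by (simp add: divide_quad_def)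
  assume "x \<noteq> 0"
  then have n: "quad_norm x \<noteq> 0" using quad_norm_eq_0 by blast
  have "(qre x - qim x) / quad_norm x * qre x + quad_const * (- qim x / quad_norm x * qim x)
      = quad_norm x / quad_norm x"
    unfolding quad_norm_def[of x]
    by (simp add: diff_divide_distrib[symmetric] add_divide_distrib[symmetric] algebra_simps)
  then show "inverse x * x = 1"
    using n by (simp add: inverse_quad_def times_quad_def one_quad_def field_simps)
qed

end

lemma card_quad: "card (UNIV :: 'a::{field,finite} quad set) = (card (UNIV :: 'a set))\<^sup>2"
proof -
  have "bij (\<lambda>z::'a quad. (qre z, qim z))"
    by (rule bijI[OF injI surjI[where f = "\<lambda>(a, b). Quad a b"]]) (auto intro: quad.expand)
  then have "card (UNIV :: 'a quad set) = card (UNIV :: ('a \<times> 'a) set)"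
    by (rule bij_betw_same_card)
  then show ?thesis
    by (simp add: card_cartesian_product power2_eq_square UNIV_Times_UNIV[symmetric]
        del: UNIV_Times_UNIV)
qed

definition emb :: "'a::{field,finite} \<Rightarrow> 'a quad" where
  "emb c = Quad c 0"

lemma emb_simps [simp]:
  "emb 0 = 0" "emb 1 = 1" "emb (a + b) = emb a + emb b" "emb (a - b) = emb a - emb b"
  "emb (- a) = - emb a" "emb (a * b) = emb a * emb b"
  by (simp_all add: emb_def zero_quad_def one_quad_def plus_quad_def minus_quad_def
      uminus_quad_def times_quad_def)

lemma emb_eq_0_iff [simp]: "emb a = 0 \<longleftrightarrow> a = 0"
  by (simp add: emb_def zero_quad_def)

lemma emb_inverse [simp]: "emb (inverse a) = inverse (emb a)"
proof (cases "a = 0")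
  case False
  then have "emb (inverse a) * emb a = 1" by (metis emb_simps(2,6) left_inverse)
  then show ?thesis by (metis inverse_unique mult.commute)
qed simp

definition indep :: "'a::{field,finite} quad \<Rightarrow> 'a quad \<Rightarrow> bool" where
  "indep x y \<longleftrightarrow> (\<forall>a b. emb a * x + emb b * y = 0 \<longrightarrow> a = 0 \<and> b = 0)"

text \<open>A counting argument: packing the coefficients \<open>(a, b)\<close> into one element of
  the extension makes the combination map an injective self-map of a finite type, hence
  surjective.\<close>

lemma indep_span:
  assumes "indep x y"
  obtains a b where "z = emb a * x + emb b * y"
proof -
  let ?f = "\<lambda>w. emb (qre w) * x + emb (qim w) * y"
  have "inj ?f"
  proof (rule injI)
    fix w w' assume *: "?f w = ?f w'"
    have "emb (qre w - qre w') * x + emb (qim w - qim w') * y = ?f w - ?f w'"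
      unfolding emb_simps by (simp only: left_diff_distrib add_diff_add)
    also have "\<dots> = 0" unfolding * by simp
    finally have "emb (qre w - qre w') * x + emb (qim w - qim w') * y = 0" .
    with assms have "qre w - qre w' = 0 \<and> qim w - qim w' = 0"
      unfolding indep_def by blast
    then show "w = w'" by (cases w; cases w') simp
  qed
  then have "surj ?f" by (rule finite_UNIV_inj_surj[OF finite])
  then obtain w where "z = ?f w" by blast
  then show thesis by (rule that)
qed

lemma indepI:
  assumes "x \<noteq> 0" and "\<And>c. y \<noteq> emb c * x"
  shows "indep x y"
  unfolding indep_def
proof (intro allI impI)
  fix a b assume e: "emb a * x + emb b * y = 0"
  have b: "b = 0"
  proof (rule ccontr)
    assume b: "b \<noteq> 0"
    have "emb b * y = - emb a * x" using e by (simp add: add_eq_0_iff)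
    then have "y = inverse (emb b) * (- emb a * x)"
      using b by (metis emb_eq_0_iff left_inverse mult.assoc mult_1)
    then have "y = emb (inverse b * - a) * x" by simp
    with assms(2) show False by blast
  qed
  with e assms(1) show "a = 0 \<and> b = 0" by simp
qed

lemma indep_1_theta: "indep 1 (Quad 0 1)"
  by (rule indepI) (simp_all add: emb_def)

section \<open>Spread lines with special points\<close>

definition scl :: "'k::field \<Rightarrow> 'k \<times> 'k \<Rightarrow> 'k \<times> 'k" where
  "scl x d = (x * fst d, x * snd d)"

lemma scl_simps [simp]: "scl 0 d = 0" "scl (- x) d = - scl x d"
  by (simp_all add: scl_def zero_prod_def)

lemma scl_add: "scl (x + y) d = scl x d + scl y d"
  by (simp add: scl_def algebra_simps)

lemma scl_diff: "scl (x - y) d = scl x d - scl y d"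
  by (simp add: scl_def algebra_simps)

lemma scl_mult: "scl (x * y) d = scl x (scl y d)"
  by (simp add: scl_def algebra_simps)

lemma scl_add_right: "scl x (v + w) = scl x v + scl x w"
  by (simp add: scl_def algebra_simps)

text \<open>Over the subfield, the \<open>K\<close>-lines of \<open>K \<times> K\<close> form a line spread of a 4-dimensional space.\<close>

definition dirs :: "('k::field \<times> 'k) set" where
  "dirs = insert (0, 1) (range (Pair 1))"

lemma card_dirs: "card (dirs :: ('k::{field,finite} \<times> 'k) set) = card (UNIV :: 'k set) + 1"
proof -
  have "(0, 1) \<notin> range (Pair (1::'k) :: 'k \<Rightarrow> _)" by auto
  moreover have "card (range (Pair (1::'k) :: 'k \<Rightarrow> _)) = card (UNIV :: 'k set)"
    by (rule card_image) (simp add: inj_on_def)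
  ultimately show ?thesis unfolding dirs_def by simp
qed

lemma scl_eq_0_iff: "d \<in> dirs \<Longrightarrow> scl x d = 0 \<longleftrightarrow> x = 0"
  by (auto simp: dirs_def scl_def zero_prod_def)

text \<open>This is the skewness of distinct spread lines. Only two directions of the form
  \<open>(1, m)\<close> and \<open>(1, m')\<close> need the computation below; the direction
  \<open>(0, 1)\<close> is settled by the first component.\<close>

lemma dirs_indep:
  assumes "d \<in> dirs" "d' \<in> dirs" "d \<noteq> d'" "scl x d + scl y d' = 0"
  shows "x = 0 \<and> y = 0"
proof -
  have *: "x = 0 \<and> y = 0" if *: "x * m + y * m' = 0" "x + y = 0" and n: "m \<noteq> m'" for m m'
  proof -
    from *(2) have y: "y = - x" by (simp add: add_eq_0_iff)
    from *(1) have "x * (m - m') = 0" unfolding y by (simp add: algebra_simps)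
    with n y show ?thesis by simp
  qed
  show ?thesis
    using assms by (auto simp: dirs_def scl_def zero_prod_def dest: *)
qed

text \<open>Each nonzero vector lies on a single spread line with a unique coordinate, so a set of
  nonzero vectors can be counted line by line.\<close>

lemma scl_dirs_inj:
  assumes "d \<in> dirs" "d' \<in> dirs" "scl x d = scl y d'" "x \<noteq> 0"
  shows "d = d' \<and> x = y"
proof -
  have "d = d'"
  proof (rule ccontr)
    assume "d \<noteq> d'"
    moreover have "scl x d + scl (- y) d' = 0" using assms by simp
    ultimately show False using dirs_indep assms by blast
  qed
  moreover from this have "scl (x - y) d = 0" using assms by (simp add: scl_diff)
  ultimately show ?thesis using scl_eq_0_iff[OF assms(1)] by simp
qed

section \<open>Points of a line and triples of special points\<close>

text \<open>For nonzero \<open>g\<close> this is a projective point of a spread line, kept as the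
  set of all its representing vectors.\<close>

definition ray :: "'a::{field,finite} quad \<Rightarrow> 'a quad set" where
  "ray g = (\<lambda>c. emb c * g) ` (- {0})"

lemma card_ray:
  fixes g :: "'a::{field,finite} quad"
  shows "card (ray g) \<le> card (UNIV :: 'a set) - 1"
proof -
  have "card (ray g) \<le> card (- {0 :: 'a})"
    unfolding ray_def by (rule card_image_le) simp
  then show ?thesis by (simp add: Compl_eq_Diff_UNIV)
qed

lemma in_ray: "h = emb s * g \<Longrightarrow> h \<noteq> 0 \<Longrightarrow> h \<in> ray g"
  unfolding ray_def by (intro image_eqI[where x = s]) auto

lemma ray_refl: "g \<in> ray g"
  unfolding ray_def by (rule image_eqI[where x = 1]) simp_all

lemma ray_mult: "h \<in> ray g \<Longrightarrow> c \<noteq> 0 \<Longrightarrow> emb c * h \<in> ray g"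
proof -
  assume "h \<in> ray g" "c \<noteq> 0"
  then obtain b where "b \<noteq> 0" "h = emb b * g" unfolding ray_def by auto
  then have "emb c * h = emb (c * b) * g" "c * b \<noteq> 0"
    using \<open>c \<noteq> 0\<close> by (simp_all add: mult.assoc)
  then show ?thesis unfolding ray_def by blast
qed

lemma ray_mult_iff:
  assumes "c \<noteq> 0" shows "emb c * h \<in> ray g \<longleftrightarrow> h \<in> ray g"
proof
  assume "emb c * h \<in> ray g"
  from ray_mult[OF this, of "inverse c"] show "h \<in> ray g"
    using assms by (simp add: mult.assoc[symmetric])
qed (rule ray_mult[OF _ assms])

text \<open>Any three points of a line are spanned by \<open>x\<close>, \<open>y\<close> and \<open>x - y\<close> for a suitable basis \<open>x, y\<close>.\<close>

definition special_pts :: "'a::{field,finite} quad \<Rightarrow> 'a quad \<Rightarrow> 'a quad set" where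
  "special_pts x y = ray x \<union> ray y \<union> ray (x - y)"

lemma card_special_pts:
  fixes x y :: "'a::{field,finite} quad"
  shows "card (special_pts x y) \<le> 3 * (card (UNIV :: 'a set) - 1)"
  using card_Un_le[of "ray x \<union> ray y" "ray (x - y)"] card_Un_le[of "ray x" "ray y"]
    card_ray[of x] card_ray[of y] card_ray[of "x - y"]
  unfolding special_pts_def by linarith

lemma special_pts_mult: "p \<in> special_pts x y \<Longrightarrow> c \<noteq> 0 \<Longrightarrow> emb c * p \<in> special_pts x y"
  unfolding special_pts_def by (auto simp: ray_mult_iff)

lemma special_pts_base: "x \<in> special_pts x y" "y \<in> special_pts x y" "x - y \<in> special_pts x y"
  unfolding special_pts_def by (simp_all add: ray_refl)

lemma special_pts_minus: "p \<in> special_pts x y \<Longrightarrow> - p \<in> special_pts x y"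
  using special_pts_mult[of p x y "- 1"] by simp

lemma indep_zero: "\<not> indep 0 y" "\<not> indep x 0" "\<not> indep x x"
proof -
  have "emb 1 * 0 + emb 0 * y = 0" "emb 0 * x + emb 1 * 0 = 0" "emb 1 * x + emb (- 1) * x = 0"
    by simp_all
  then show "\<not> indep 0 y" "\<not> indep x 0" "\<not> indep x x"
    unfolding indep_def by (metis one_neq_zero)+
qed

lemma special_pts_nonzero: "indep x y \<Longrightarrow> 0 \<notin> special_pts x y"
  by (auto simp: special_pts_def ray_def indep_zero)

text \<open>\<open>G\<close> has more vectors than two rays, so it contains \<open>a\<close>,
  \<open>b\<close>, \<open>c\<close> in three distinct rays. In \<open>c = s a + t b\<close> both
  coefficients are nonzero, and the basis \<open>s a\<close>, \<open>- t b\<close> has difference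
  \<open>c\<close>. The prescribed \<open>a\<close> serves to place a point that two lines
  share.\<close>

lemma exists_indep_triple:
  fixes G :: "'a::{field,finite} quad set"
  assumes G0: "0 \<notin> G" and Gm: "\<And>c g. c \<noteq> 0 \<Longrightarrow> g \<in> G \<Longrightarrow> emb c * g \<in> G"
    and card: "2 * (card (UNIV :: 'a set) - 1) < card G" and a: "a \<in> G"
  obtains x y where "indep x y" "special_pts x y \<subseteq> G" "a \<in> special_pts x y"
proof -
  have "card (ray a) < card G" using card_ray[of a] card by linarith
  then have "\<not> G \<subseteq> ray a" using card_mono[of "ray a" G] by auto
  then obtain b where b: "b \<in> G" "b \<notin> ray a" by blast
  have "card (ray a \<union> ray b) < card G"
    using card_Un_le[of "ray a" "ray b"] card_ray[of a] card_ray[of b] card by linarith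
  then have "\<not> G \<subseteq> ray a \<union> ray b" using card_mono[of "ray a \<union> ray b" G] by auto
  then obtain c where c: "c \<in> G" "c \<notin> ray a" "c \<notin> ray b" by blast
  have nz: "a \<noteq> 0" "b \<noteq> 0" "c \<noteq> 0" using a b c G0 by auto
  have ab: "indep a b"
    by (rule indepI[OF nz(1)]) (use b(2) in_ray[of b _ a] nz in auto)
  obtain s t where st: "c = emb s * a + emb t * b" using indep_span[OF ab] .
  have s: "s \<noteq> 0" using st in_ray[of c t b] c nz by auto
  have t: "t \<noteq> 0" using st in_ray[of c s a] c nz by auto
  let ?x = "emb s * a" and ?y = "emb (- t) * b"
  have xy: "?x - ?y = c" using st by simp
  have "indep ?x ?y"
    unfolding indep_def
  proof (intro allI impI)
    fix u v assume "emb u * ?x + emb v * ?y = 0"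
    then have "emb (u * s) * a + emb (v * - t) * b = 0" by (simp only: emb_simps mult.assoc)
    then have "u * s = 0 \<and> v * - t = 0" using ab unfolding indep_def by blast
    then show "u = 0 \<and> v = 0" using s t by simp
  qed
  moreover have "special_pts ?x ?y \<subseteq> G"
  proof -
    have "{?x, ?y, ?x - ?y} \<subseteq> G"
      unfolding xy using Gm[OF s a] Gm[of "- t" b] b(1) c(1) t by simp
    then show ?thesis unfolding special_pts_def ray_def using Gm by (auto simp del: emb_simps)
  qed
  moreover have "a \<in> special_pts ?x ?y"
  proof -
    have "emb (inverse s) * ?x = a" using s by (simp add: mult.assoc[symmetric])
    moreover have "emb (inverse s) * ?x \<in> special_pts ?x ?y"
      using s by (intro special_pts_mult[OF special_pts_base(1)]) simp
    ultimately show ?thesis by (simp only:)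
  qed
  ultimately show thesis by (rule that)
qed

section \<open>Line arrangements and the greedy extension step\<close>

text \<open>Injectivity of \<open>d\<close> makes the lines skew. Since points of two skew lines are
  independent and \<open>special_pts\<close> absorbs nonzero scalars, a vanishing sum of three
  special vectors is exactly a collinear triple. Increasing indices suffice by symmetry.\<close>

definition arrangement ::
    "nat \<Rightarrow> (nat \<Rightarrow> 'a quad \<times> 'a quad) \<Rightarrow> (nat \<Rightarrow> 'a::{field,finite} quad) \<Rightarrow> (nat \<Rightarrow> 'a quad) \<Rightarrow> bool"
  where "arrangement m d x y \<longleftrightarrow>
    (\<forall>i<m. d i \<in> dirs \<and> indep (x i) (y i)) \<and> inj_on d {..<m} \<and>
    (\<forall>k<m. \<forall>j<k. \<forall>i<j. \<forall>p \<in> special_pts (x i) (y i).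
      \<forall>q \<in> special_pts (x j) (y j). \<forall>r \<in> special_pts (x k) (y k).
       scl p (d i) + scl q (d j) + scl r (d k) \<noteq> 0)"

lemma arrangement_Suc:
  assumes "arrangement m d x y" "e \<in> dirs" "e \<notin> d ` {..<m}" "indep u v"
    and "\<And>i j p q r. i < j \<Longrightarrow> j < m \<Longrightarrow> p \<in> special_pts (x i) (y i) \<Longrightarrow> q \<in> special_pts (x j) (y j) \<Longrightarrow>
      r \<in> special_pts u v \<Longrightarrow> scl p (d i) + scl q (d j) + scl r e \<noteq> 0"
  shows "arrangement (Suc m) (d(m := e)) (x(m := u)) (y(m := v))"
proof -
  have "inj_on (d(m := e)) {..<Suc m}"
    using assms(1,3) unfolding arrangement_def
    by (auto simp: lessThan_Suc inj_on_def)
  moreover have "\<forall>i<Suc m. (d(m := e)) i \<in> dirs \<and> indep ((x(m := u)) i) ((y(m := v)) i)"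
    using assms(1,2,4) unfolding arrangement_def by (auto simp: less_Suc_eq)
  moreover have "scl p ((d(m := e)) i) + scl q ((d(m := e)) j) + scl r ((d(m := e)) k) \<noteq> 0"
    if "k < Suc m" "j < k" "i < j"
      "p \<in> special_pts ((x(m := u)) i) ((y(m := v)) i)"
        "q \<in> special_pts ((x(m := u)) j) ((y(m := v)) j)"
      "r \<in> special_pts ((x(m := u)) k) ((y(m := v)) k)" for i j k p q r
  proof (cases "k = m")
    case True
    with that show ?thesis using assms(5)[of i j p q r] by simp
  next
    case False
    with that have "k < m" "j < m" "i < m" by auto
    with that assms(1) show ?thesis unfolding arrangement_def by simp
  qed
  ultimately show ?thesis unfolding arrangement_def by blast
qed

lemma sum_lessThan_double: "2 * (\<Sum>j<m. j) = m * (m - 1)" for m :: nat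
proof (induction m)
  case (Suc m)
  then show ?case by (cases m) (simp_all add: algebra_simps)
qed simp

text \<open>The set \<open>S\<close> below consists of the vectors on the lines joining two special points, the special
  points themselves excluded. A spread line with fewer than \<open>(Q - 1)\<^sup>2\<close> vectors in \<open>S\<close> keeps
  three free points. Each pair of old lines gives \<open>9 (Q - 1)\<^sup>2\<close> vectors of \<open>S\<close>, hence the hypothesis
  on \<open>m\<close>.\<close>

lemma arrangement_extend:
  fixes d :: "nat \<Rightarrow> 'a::{field,finite} quad \<times> 'a quad"
  assumes arr: "arrangement m d x y"
    and Q: "Q = card (UNIV :: 'a set)"
    and m: "9 * (m * (m - 1)) + 2 * m < 2 * (Q\<^sup>2 + 1)"
  obtains e u v where "arrangement (Suc m) (d(m := e)) (x(m := u)) (y(m := v))"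
proof -
  let ?P = "\<lambda>i. special_pts (x i) (y i)"
  define S where
    "S = (\<Union>j<m. \<Union>i<j. (\<lambda>(p, q). scl p (d i) + scl q (d j)) ` (?P i \<times> ?P j))"
  define D where "D = dirs - d ` {..<m}"
  define X where "X e = {r. scl r e \<in> S}" for e
  have dirs: "d i \<in> dirs" "indep (x i) (y i)" if "i < m" for i
    using arr that unfolding arrangement_def by auto
  have inj: "inj_on d {..<m}" using arr unfolding arrangement_def by auto
  have "card (UNIV :: 'a set) \<ge> card {0, 1 :: 'a}" by (rule card_mono) auto
  then have Q2: "Q \<ge> 2" unfolding Q by simp

  have "card S \<le> (\<Sum>j<m. card (\<Union>i<j. (\<lambda>(p, q). scl p (d i) + scl q (d j)) ` (?P i \<times> ?P j)))"
    unfolding S_def by (rule card_UN_le) simp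
  also have "\<dots> \<le> (\<Sum>j<m. \<Sum>i<j. card ((\<lambda>(p, q). scl p (d i) + scl q (d j)) ` (?P i \<times> ?P j)))"
    by (intro sum_mono card_UN_le) simp
  also have "\<dots> \<le> (\<Sum>j<m. \<Sum>i<j. (3 * (Q - 1)) * (3 * (Q - 1)))"
  proof (intro sum_mono)
    fix i j
    have "card ((\<lambda>(p, q). scl p (d i) + scl q (d j)) ` (?P i \<times> ?P j)) \<le> card (?P i \<times> ?P j)"
      by (rule card_image_le) simp
    also have "\<dots> \<le> (3 * (Q - 1)) * (3 * (Q - 1))"
      unfolding card_cartesian_product Q by (intro mult_le_mono card_special_pts)
    finally show "card ((\<lambda>(p, q). scl p (d i) + scl q (d j)) ` (?P i \<times> ?P j))
      \<le> (3 * (Q - 1)) * (3 * (Q - 1))" .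
  qed
  also have "\<dots> = (\<Sum>j<m. j * (9 * (Q - 1)\<^sup>2))"
    by (simp add: power2_eq_square)
  also have "\<dots> = 9 * (Q - 1)\<^sup>2 * (\<Sum>j<m. j)"
    by (simp only: sum_distrib_right[symmetric] mult.commute)
  finally have "2 * card S \<le> 2 * (9 * (Q - 1)\<^sup>2 * (\<Sum>j<m. j))" by (rule mult_le_mono2)
  also have "\<dots> = 9 * (Q - 1)\<^sup>2 * (2 * (\<Sum>j<m. j))" by (rule mult.left_commute)
  finally have cS: "2 * card S \<le> 9 * (Q - 1)\<^sup>2 * (m * (m - 1))"
    by (simp only: sum_lessThan_double)

  have S_mem: "\<exists>i j p q. i < j \<and> j < m \<and> p \<in> ?P i \<and> q \<in> ?P j \<and> v = scl p (d i) + scl q (d j)"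
    if "v \<in> S" for v using that by (auto simp: S_def)
  have S_I: "scl p (d i) + scl q (d j) \<in> S" if "i < j" "j < m" "p \<in> ?P i" "q \<in> ?P j" for i j p q
    unfolding S_def
    by (rule UN_I[of j], use that in simp, rule UN_I[of i], use that in simp,
        rule image_eqI[where x = "(p, q)"]) (use that in simp_all)
  \<comment> \<open>Zero lies on every spread line; excluding it makes the traces of
    \<open>S\<close> on the spread lines disjoint.\<close>
  have S0: "0 \<notin> S"
  proof
    assume "0 \<in> S"
    then obtain i j p q where *: "i < j" "j < m" "p \<in> ?P i" "scl p (d i) + scl q (d j) = 0"
      using S_mem[of 0] by metis
    then have "d i \<noteq> d j" using inj by (auto simp: inj_on_def)
    then have "p = 0" using dirs_indep[of "d i" "d j" p q] * dirs[of i] dirs[of j] by simp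
    then show False using * dirs(2)[of i] special_pts_nonzero[of "x i" "y i"] by simp
  qed
  have cD: "card D = Q\<^sup>2 + 1 - m"
  proof -
    have "card D = card (dirs :: ('a quad \<times> 'a quad) set) - card (d ` {..<m})"
      unfolding D_def using dirs by (intro card_Diff_subset) auto
    then show ?thesis using card_image[OF inj] by (simp add: card_dirs card_quad Q)
  qed
  have "\<exists>e\<in>D. card (X e) < (Q - 1)\<^sup>2"
  proof (rule ccontr)
    assume "\<not> ?thesis"
    then have "(\<Sum>e\<in>D. (Q - 1)\<^sup>2) \<le> (\<Sum>e\<in>D. card (X e))"
      by (intro sum_mono) (auto simp: not_less)
    also have "\<dots> = card (SIGMA e:D. X e)" by (rule card_SigmaI[symmetric]) auto
    also have "\<dots> \<le> card S"
    proof (rule card_inj_on_le)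
      show "inj_on (\<lambda>(e, r). scl r e) (SIGMA e:D. X e)"
      proof (rule inj_onI, clarify)
        fix e r e' r'
        assume *: "e \<in> D" "r \<in> X e" "e' \<in> D" "r' \<in> X e'" "scl r e = scl r' e'"
        have "r \<noteq> 0" using *(2) S0 by (auto simp: X_def)
        then show "e = e' \<and> r = r'" using scl_dirs_inj[of e e' r r'] * unfolding D_def by simp
      qed
    qed (auto simp: X_def)
    finally have "card D * (Q - 1)\<^sup>2 \<le> card S" by simp
    then have "2 * (card D * (Q - 1)\<^sup>2) \<le> 9 * (Q - 1)\<^sup>2 * (m * (m - 1))"
      using cS by linarith
    then have "(Q - 1)\<^sup>2 * (2 * card D) \<le> (Q - 1)\<^sup>2 * (9 * (m * (m - 1)))"
      by (simp only: ac_simps)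
    moreover have "0 < (Q - 1)\<^sup>2" using Q2 by simp
    ultimately have "2 * card D \<le> 9 * (m * (m - 1))" by (simp only: nat_mult_le_cancel1)
    \<comment> \<open>Stated for arbitrary \<open>a\<close> and \<open>b\<close> to deal with the
      truncated subtraction in \<open>card D\<close>.\<close>
    moreover have "2 * (a - m) \<le> b \<Longrightarrow> b + 2 * m < 2 * a \<Longrightarrow> False" for a b :: nat by linarith
    ultimately show False using m unfolding cD by blast
  qed
  then obtain e where e: "e \<in> D" "card (X e) < (Q - 1)\<^sup>2" by blast
  define G where "G = - X e - {0}"
  \<comment> \<open>At least \<open>Q\<^sup>2 - 1 - ((Q - 1)\<^sup>2 - 1) = 2 * Q - 1\<close>
    nonzero vectors are free, more than two rays hold.\<close>
  have cG: "2 * (Q - 1) < card G"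
  proof -
    have "Q * Q = card (UNIV :: 'a quad set)" by (simp add: card_quad Q power2_eq_square)
    also have "\<dots> \<le> card (X e \<union> {0} \<union> G)" by (intro card_mono) (auto simp: G_def)
    also have "\<dots> \<le> card (X e \<union> {0}) + card G" by (rule card_Un_le)
    also have "\<dots> \<le> card (X e) + 1 + card G" using card_Un_le[of "X e" "{0}"] by simp
    also have "\<dots> < (Q - 1)\<^sup>2 + 1 + card G" using e by simp
    finally have *: "Q * Q < (Q - 1)\<^sup>2 + 1 + card G" .
    obtain t where "Q = Suc t" using Q2 by (cases Q) auto
    with * show ?thesis by (simp add: power2_eq_square)
  qed
  have S_mult: "scl (emb c) v \<in> S" if "v \<in> S" "c \<noteq> 0" for c v
  proof -
    obtain i j p q where *: "i < j" "j < m" "p \<in> ?P i" "q \<in> ?P j" "v = scl p (d i) + scl q (d j)"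
      using S_mem[OF \<open>v \<in> S\<close>] by blast
    then have "scl (emb c) v = scl (emb c * p) (d i) + scl (emb c * q) (d j)"
      by (simp add: scl_mult scl_add_right)
    then show ?thesis using S_I[OF *(1,2) special_pts_mult[OF *(3)] special_pts_mult[OF *(4)]]
      that by simp
  qed
  \<comment> \<open>\<open>S\<close> is closed under nonzero scalars, hence so is its complement: a
    covered multiple of \<open>g\<close> could be scaled back by \<open>inverse c\<close>.\<close>
  have Gm: "emb c * g \<in> G" if "c \<noteq> 0" "g \<in> G" for c g
  proof -
    have "emb c * g \<notin> X e"
    proof
      assume "emb c * g \<in> X e"
      then have "scl (emb c) (scl g e) \<in> S" by (simp add: X_def scl_mult)
      then have "scl (emb (inverse c)) (scl (emb c) (scl g e)) \<in> S"
        by (rule S_mult) (use that in simp)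
      moreover have "scl (emb (inverse c)) (scl (emb c) (scl g e)) = scl g e"
        using that by (simp add: scl_mult[symmetric] mult.assoc[symmetric])
      ultimately have "scl g e \<in> S" by simp
      then show False using that by (simp add: G_def X_def)
    qed
    then show ?thesis using that by (simp add: G_def)
  qed
  have G0: "0 \<notin> G" by (simp add: G_def)
  have "G \<noteq> {}" using cG by auto
  then obtain a where a: "a \<in> G" by blast
  obtain u v where uv: "indep u v" "special_pts u v \<subseteq> G"
    using exists_indep_triple[OF G0 Gm cG[unfolded Q] a] by blast
  have "arrangement (Suc m) (d(m := e)) (x(m := u)) (y(m := v))"
  proof (rule arrangement_Suc[OF arr _ _ uv(1)])
    show "e \<in> dirs" "e \<notin> d ` {..<m}" using e by (auto simp: D_def)
    fix i j p q r
    assume *: "i < j" "j < m" "p \<in> ?P i" "q \<in> ?P j" "r \<in> special_pts u v"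
    show "scl p (d i) + scl q (d j) + scl r e \<noteq> 0"
    proof
      assume "scl p (d i) + scl q (d j) + scl r e = 0"
      then have "scl r e = scl (- p) (d i) + scl (- q) (d j)"
        by (simp add: add_eq_0_iff)
      then have "r \<in> X e"
        using S_I[OF *(1,2) special_pts_minus[OF *(3)] special_pts_minus[OF *(4)]]
          by (simp add: X_def)
      then show False using uv(2) *(5) by (auto simp: G_def)
    qed
  qed
  then show thesis by (rule that)
qed

lemma arrangement_0: "arrangement 0 d x y"
  by (simp add: arrangement_def)

lemma exists_arrangement:
  assumes "Q = card (UNIV :: 'a::{field,finite} set)"
    and "\<And>k. k < m \<Longrightarrow> 9 * (k * (k - 1)) + 2 * k < 2 * (Q\<^sup>2 + 1)"
  shows "\<exists>d x (y :: nat \<Rightarrow> 'a quad). arrangement m d x y"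
  using assms(2)
proof (induction m)
  case 0
  show ?case using arrangement_0 by blast
next
  case (Suc m)
  then obtain d x and y :: "nat \<Rightarrow> 'a quad" where "arrangement m d x y" by force
  from arrangement_extend[OF this assms(1) Suc.prems] show ?case by blast
qed

section \<open>Three initial lines with a transversal\<close>

text \<open>\<open>r\<close> ranges over the whole third line; in an arrangement of at least three
  lines it cannot be special. The relation will give a word with weights at most 2, 2 and 3 on the
  first three groups.\<close>

definition has_transversal where
  "has_transversal d x y \<longleftrightarrow> (\<exists>p \<in> special_pts (x 0) (y 0). \<exists>q \<in> special_pts (x 1) (y 1). \<exists>r.
     scl p (d 0) + scl q (d 1) + scl r (d (2 :: nat)) = 0)"

text \<open>On the lines with directions \<open>(1, 0)\<close>, \<open>(0, 1)\<close>, \<open>(1, 1)\<close> the vectors \<open>p, q, r\<close> are dependent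
  only if they are proportional in \<open>K\<close>. So the first two lines may share a point, as long as
  the third one avoids it; four elements are needed to leave enough room.\<close>

lemma exists_arrangement_3:
  assumes Q: "Q = card (UNIV :: 'a::{field,finite} set)" "Q \<ge> 4"
  shows "\<exists>d x (y :: nat \<Rightarrow> 'a quad). arrangement 3 d x y \<and> has_transversal d x y"
proof -
  let ?t = "Quad 0 1 :: 'a quad"
  \<comment> \<open>The first line gets the special points of \<open>1\<close>, \<open>?t\<close>
    and \<open>1 - ?t\<close>. \<open>G1\<close> lets the second line share only
    \<open>ray 1\<close> with it, and \<open>G2\<close> keeps the third line off
    \<open>ray 1\<close>.\<close>
  define G1 where "G1 = - {0} - ray ?t - ray (1 - ?t)"
  define G2 where "G2 = - {0} - ray (1 :: 'a quad)"
  have G1: "0 \<notin> G1" "\<And>c g. c \<noteq> 0 \<Longrightarrow> g \<in> G1 \<Longrightarrow> emb c * g \<in> G1"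
    by (auto simp: G1_def ray_mult_iff)
  have G2: "0 \<notin> G2" "\<And>c g. c \<noteq> 0 \<Longrightarrow> g \<in> G2 \<Longrightarrow> emb c * g \<in> G2"
    by (auto simp: G2_def ray_mult_iff)
  have UN: "card (UNIV :: 'a quad set) = Q * Q" by (simp add: card_quad Q power2_eq_square)
  have Q4: "4 * Q \<le> Q * Q" using Q(2) by simp
  have cr: "card (ray g) \<le> Q - 1" for g :: "'a quad" using card_ray[of g] Q(1) by simp
  \<comment> \<open>The count \<open>Q\<^sup>2 - 1 - 2 * (Q - 1) > 2 * (Q - 1)\<close> amounts to
    \<open>Q + 1 > 4\<close>.\<close>
  have c1: "2 * (Q - 1) < card G1"
  proof -
    have "card (UNIV :: 'a quad set) \<le> card (G1 \<union> {0} \<union> ray ?t \<union> ray (1 - ?t))"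
      by (intro card_mono) (auto simp: G1_def)
    also have "\<dots> \<le> card (G1 \<union> {0} \<union> ray ?t) + card (ray (1 - ?t))" by (rule card_Un_le)
    also have "\<dots> \<le> card (G1 \<union> {0}) + card (ray ?t) + card (ray (1 - ?t))"
      by (intro add_mono card_Un_le order.refl)
    also have "\<dots> \<le> card G1 + 1 + (Q - 1) + (Q - 1)"
      using card_Un_le[of G1 "{0}"] by (intro add_mono cr) simp_all
    finally show ?thesis using UN Q4 Q(2) by linarith
  qed
  have c2: "2 * (Q - 1) < card G2"
  proof -
    have "card (UNIV :: 'a quad set) \<le> card (G2 \<union> {0} \<union> ray 1)"
      by (intro card_mono) (auto simp: G2_def)
    also have "\<dots> \<le> card (G2 \<union> {0}) + card (ray (1 :: 'a quad))" by (rule card_Un_le)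
    also have "\<dots> \<le> card G2 + 1 + (Q - 1)"
      using card_Un_le[of G2 "{0}"] by (intro add_mono cr) simp_all
    finally show ?thesis using UN Q4 Q(2) by linarith
  qed
  have "1 \<in> G1"
    unfolding G1_def
    by (auto simp: ray_def emb_def times_quad_def one_quad_def zero_quad_def minus_quad_def)
  then obtain x1 y1 where 1: "indep x1 y1" "special_pts x1 y1 \<subseteq> G1" "1 \<in> special_pts x1 y1"
    using exists_indep_triple[OF G1(1,2) c1[unfolded Q(1)]] by blast
  have "G2 \<noteq> {}" using c2 by auto
  then obtain a where "a \<in> G2" by blast
  then obtain x2 y2 where 2: "indep x2 y2" "special_pts x2 y2 \<subseteq> G2"
    using exists_indep_triple[OF G2(1,2) c2[unfolded Q(1)]] by blast
  \<comment> \<open>The zeros from index 2 on are placeholders; adding the third line overwrites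
    index 2.\<close>
  define d :: "nat \<Rightarrow> 'a quad \<times> 'a quad" where
    "d = ((\<lambda>_. 0)(0 := (1, 0)))(1 := (0, 1))"
  define x where "x = ((\<lambda>_::nat. 0)(0 := 1))(1 := x1)"
  define y where "y = ((\<lambda>_::nat. 0)(0 := ?t))(1 := y1)"
  have "arrangement (Suc 0) ((\<lambda>_. 0)(0 := (1, 0))) ((\<lambda>_. 0)(0 := 1)) ((\<lambda>_. 0)(0 := ?t))"
    by (rule arrangement_Suc[OF arrangement_0]) (auto simp: dirs_def indep_1_theta)
  then have "arrangement (Suc 1) d x y"
    unfolding d_def x_def y_def One_nat_def
    by (rule arrangement_Suc) (auto simp: dirs_def 1(1))
  then have "arrangement (Suc (Suc 1)) (d(Suc 1 := (1, 1))) (x(Suc 1 := x2)) (y(Suc 1 := y2))"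
  proof (rule arrangement_Suc)
    show "(1, 1) \<in> dirs" "(1, 1) \<notin> d ` {..<Suc 1}"
      by (auto simp: dirs_def d_def lessThan_Suc)
    show "indep x2 y2" by (rule 2)
    fix i j :: nat and p q r
    assume "i < j" "j < Suc 1"
    then have ij: "i = 0" "j = 1" by auto
    assume p: "p \<in> special_pts (x i) (y i)"
      and q: "q \<in> special_pts (x j) (y j)" and r: "r \<in> special_pts x2 y2"
    show "scl p (d i) + scl q (d j) + scl r (1, 1) \<noteq> 0"
    proof
      assume "scl p (d i) + scl q (d j) + scl r (1, 1) = 0"
      then have "p + r = 0" "q + r = 0"
        unfolding ij by (simp_all add: d_def scl_def zero_prod_def)
      then have e: "q = p" "r = emb (- 1) * p"
        by (simp_all add: add_eq_0_iff)
      \<comment> \<open>As \<open>p = q\<close> is special on both lines, it lies in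
        \<open>ray 1\<close>, and then so does \<open>r\<close>, against the choice of
        \<open>G2\<close>.\<close>
      have "p \<in> G1" using q 1(2) unfolding ij e by (auto simp: x_def y_def)
      moreover have "p \<in> special_pts 1 ?t" using p unfolding ij by (simp add: x_def y_def)
      ultimately have "p \<in> ray 1" by (auto simp: special_pts_def G1_def)
      then have "r \<in> ray 1" unfolding e by (rule ray_mult) simp
      then show False using r 2(2) by (auto simp: G2_def)
    qed
  qed
  moreover have "has_transversal (d(Suc 1 := (1, 1))) (x(Suc 1 := x2)) (y(Suc 1 := y2))"
    unfolding has_transversal_def
  proof (intro bexI exI)
    \<comment> \<open>The relation \<open>(1, 0) + (0, 1) - (1, 1) = 0\<close>, with
      \<open>1\<close> special on the first two lines.\<close>
    show "scl 1 ((d(Suc 1 := (1, 1))) 0) + scl 1 ((d(Suc 1 := (1, 1))) 1)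
        + scl (- 1) ((d(Suc 1 := (1, 1))) 2) = 0"
      by (simp add: d_def scl_def zero_prod_def)
  qed (use 1(3) special_pts_base(1)[of 1 ?t] in \<open>simp_all add: x_def y_def\<close>)
  ultimately show ?thesis
    unfolding numeral_3_eq_3 One_nat_def by blast
qed

text \<open>Greedy extension starts from the three lines above. New lines get indices at least 3, so
  the transversal survives.\<close>

lemma exists_arrangement_with_transversal:
  assumes Q: "Q = card (UNIV :: 'a::{field,finite} set)" "Q \<ge> 4" and "m \<ge> 3"
    and "\<And>k. k < m \<Longrightarrow> 9 * (k * (k - 1)) + 2 * k < 2 * (Q\<^sup>2 + 1)"
  shows "\<exists>d x (y :: nat \<Rightarrow> 'a quad). arrangement m d x y \<and> has_transversal d x y"
  using \<open>m \<ge> 3\<close> assms(4)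
proof (induction m rule: dec_induct)
  case base
  show ?case by (rule exists_arrangement_3[OF Q])
next
  case (step m)
  then obtain d x and y :: "nat \<Rightarrow> 'a quad"
    where *: "arrangement m d x y" "has_transversal d x y" by force
  obtain e u v where "arrangement (Suc m) (d(m := e)) (x(m := u)) (y(m := v))"
    using arrangement_extend[OF *(1) Q(1)] step.prems by blast
  moreover have "has_transversal (d(m := e)) (x(m := u)) (y(m := v))"
    using *(2) step.hyps unfolding has_transversal_def by simp
  ultimately show ?case by blast
qed

section \<open>The code of an arrangement\<close>

definition coord :: "'a quad \<times> 'a quad \<Rightarrow> nat \<Rightarrow> 'a" where
  "coord v j = [qre (fst v), qim (fst v), qre (snd v), qim (snd v)] ! j"

lemma less_4_cases: "(j::nat) < 4 \<Longrightarrow> j = 0 \<or> j = 1 \<or> j = 2 \<or> j = 3"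
  by linarith

lemma coord_add: "j < 4 \<Longrightarrow> coord (v + w) j = coord v j + coord w j"
  by (drule less_4_cases) (auto simp: coord_def plus_quad_def)

lemma coord_scl_emb: "j < 4 \<Longrightarrow> coord (scl (emb c) v) j = c * coord v j"
  by (drule less_4_cases) (auto simp: coord_def scl_def emb_def times_quad_def)

lemma coord_zero: "j < 4 \<Longrightarrow> coord (0 :: 'a::{field,finite} quad \<times> 'a quad) j = 0"
  by (drule less_4_cases) (auto simp: coord_def zero_quad_def)

lemma coord_surj: "\<exists>v. \<forall>j<4. coord v j = f j"
proof (intro exI allI impI)
  fix j :: nat assume "j < 4"
  then show "coord (Quad (f 0) (f 1), Quad (f 2) (f 3)) j = f j"
    by (drule_tac less_4_cases) (auto simp: coord_def)
qed

lemma coord_eq_0: "(\<And>j. j < 4 \<Longrightarrow> coord v j = 0) \<Longrightarrow> v = 0"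
  for v :: "'a::{field,finite} quad \<times> 'a quad"
proof -
  assume *: "\<And>j. j < 4 \<Longrightarrow> coord v j = 0"
  from *[of 0] *[of 1] *[of 2] *[of 3] show "v = 0"
    by (cases v; cases "fst v"; cases "snd v") (simp add: coord_def zero_prod_def zero_quad_def)
qed

definition block_sum :: "'a::ab_group_add vec \<Rightarrow> nat \<Rightarrow> 'a" where
  "block_sum c i = c $ (3 * i) + c $ (3 * i + 1) + c $ (3 * i + 2)"

text \<open>In the last four rows of the parity check matrix, the columns of group \<open>i\<close> are \<open>0\<close>,
  \<open>x i\<close> and \<open>y i\<close> times the direction \<open>d i\<close>.\<close>

definition block_point ::
    "(nat \<Rightarrow> 'a::{field,finite} quad) \<Rightarrow> (nat \<Rightarrow> 'a quad) \<Rightarrow> 'a vec \<Rightarrow> nat \<Rightarrow> 'a quad" where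
  "block_point x y c i = emb (c $ (3 * i + 1)) * x i + emb (c $ (3 * i + 2)) * y i"

definition point_sum where
  "point_sum m d x y c = (\<Sum>i<m. scl (block_point x y c i) (d i))"

text \<open>All checks form one linear map into dimension \<open>m + 4\<close>, so that the
  dimension of the code follows from rank-nullity.\<close>

definition parity_check where
  "parity_check m d x y c = vec (m + 4) (\<lambda>t. if t < m then block_sum c t
    else coord (point_sum m d x y c) (t - m))"

definition line_code where
  "line_code m d x y = {c \<in> carrier_vec (3 * m). (\<forall>i<m. block_sum c i = 0)
    \<and> point_sum m d x y c = 0}"

lemma block_sum_add:
  "c \<in> carrier_vec (3 * m) \<Longrightarrow> c' \<in> carrier_vec (3 * m) \<Longrightarrow> i < m
    \<Longrightarrow> block_sum (c + c') i = block_sum c i + block_sum c' i"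
  by (simp add: block_sum_def)

lemma block_sum_smult: "c \<in> carrier_vec (3 * m) \<Longrightarrow> i < m \<Longrightarrow> block_sum (a \<cdot>\<^sub>v c) i = a * block_sum c i"
  for c :: "'a::field vec"
  by (simp add: block_sum_def distrib_left)

lemma block_point_add:
  assumes "c \<in> carrier_vec (3 * m)" "c' \<in> carrier_vec (3 * m)" "i < m"
  shows "block_point x y (c + c') i = block_point x y c i + block_point x y c' i"
  using assms by (simp add: block_point_def distrib_right)

lemma block_point_smult:
  assumes "c \<in> carrier_vec (3 * m)" "i < m"
  shows "block_point x y (a \<cdot>\<^sub>v c) i = emb a * block_point x y c i"
  using assms by (simp add: block_point_def distrib_left mult.assoc)

lemma point_sum_add:
  assumes "c \<in> carrier_vec (3 * m)" "c' \<in> carrier_vec (3 * m)"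
  shows "point_sum m d x y (c + c') = point_sum m d x y c + point_sum m d x y c'"
  using block_point_add[OF assms] by (simp add: point_sum_def scl_add sum.distrib)

lemma scl_sum: "scl a (sum f A) = (\<Sum>i\<in>A. scl a (f i))"
  by (induction A rule: infinite_finite_induct)
    (simp_all add: scl_add_right, simp_all add: scl_def zero_prod_def)

lemma point_sum_smult:
  assumes "c \<in> carrier_vec (3 * m)"
  shows "point_sum m d x y (a \<cdot>\<^sub>v c) = scl (emb a) (point_sum m d x y c)"
  using block_point_smult[OF assms] by (simp add: point_sum_def scl_mult scl_sum)

lemma parity_check_eq_0_iff:
  "parity_check m d x y c = 0\<^sub>v (m + 4) \<longleftrightarrow> (\<forall>i<m. block_sum c i = 0) \<and> point_sum m d x y c = 0"
    (is "?l \<longleftrightarrow> ?r")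
proof
  assume l: ?l
  have "block_sum c i = 0" if "i < m" for i
    using arg_cong[OF l, of "\<lambda>v. v $ i"] that by (simp add: parity_check_def)
  moreover have "point_sum m d x y c = 0"
  proof (rule coord_eq_0)
    fix j :: nat assume "j < 4"
    then show "coord (point_sum m d x y c) j = 0"
      using arg_cong[OF l, of "\<lambda>v. v $ (m + j)"] by (simp add: parity_check_def)
  qed
  ultimately show ?r by blast
qed (auto simp: parity_check_def coord_zero)

definition block_vec :: "nat \<Rightarrow> (nat \<Rightarrow> nat \<Rightarrow> 'a) \<Rightarrow> 'a vec" where
  "block_vec m f = vec (3 * m) (\<lambda>t. f (t div 3) (t mod 3))"

lemma block_vec_carrier: "block_vec m f \<in> carrier_vec (3 * m)"
  by (simp add: block_vec_def)

lemma block_vec_index: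
  assumes "i < m"
  shows "block_vec m f $ (3 * i) = f i 0" "block_vec m f $ Suc (3 * i) = f i 1"
    "block_vec m f $ Suc (Suc (3 * i)) = f i 2"
proof -
  have "Suc (3 * i) div 3 = i" "Suc (Suc (3 * i)) div 3 = i"
    "Suc (3 * i) mod 3 = 1" "Suc (Suc (3 * i)) mod 3 = 2" by presburger+
  with assms show "block_vec m f $ (3 * i) = f i 0" "block_vec m f $ Suc (3 * i) = f i 1"
    "block_vec m f $ Suc (Suc (3 * i)) = f i 2" by (simp_all add: block_vec_def)
qed

lemma sum_triple: "(\<Sum>t<3 * m. f t) = (\<Sum>i<m. f (3 * i) + f (3 * i + 1) + f (3 * i + 2))"
  for f :: "nat \<Rightarrow> 'b::comm_monoid_add"
proof (induction m)
  case (Suc m)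
  have *: "3 * Suc m = Suc (Suc (Suc (3 * m)))" by simp
  show ?case unfolding * by (simp add: Suc add.assoc)
qed simp

text \<open>Two distinct spread lines already span the 4-dimensional space, so groups 0 and 1 can
  realise any value of \<open>point_sum\<close>.\<close>

lemma parity_check_surj:
  assumes arr: "arrangement m d x y" and m: "m \<ge> 2" and w: "w \<in> carrier_vec (m + 4)"
  shows "\<exists>c \<in> carrier_vec (3 * m). parity_check m d x y c = w"
proof -
  obtain v where v: "\<And>j. j < 4 \<Longrightarrow> coord v j = w $ (m + j)" using coord_surj by meson
  have d: "d 0 \<in> dirs" "d 1 \<in> dirs" "d 0 \<noteq> d 1" and i: "indep (x 0) (y 0)" "indep (x 1) (y 1)"
    using arr m inj_on_eq_iff[of d "{..<m}" 0 1] unfolding arrangement_def by auto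
  let ?f = "\<lambda>(a, b). scl a (d 0) + scl b (d 1)"
  have "inj ?f"
  proof (rule injI, clarify)
    fix a b a' b' assume "scl a (d 0) + scl b (d 1) = scl a' (d 0) + scl b' (d 1)"
    then have "scl (a - a') (d 0) + scl (b - b') (d 1) = 0" by (simp add: scl_diff algebra_simps)
    from dirs_indep[OF d this] show "a = a' \<and> b = b'" by simp
  qed
  then have "surj ?f" by (rule finite_UNIV_inj_surj[OF finite])
  then obtain z where "v = ?f z" by blast
  then obtain z0 z1 where z: "v = scl z0 (d 0) + scl z1 (d 1)" by (cases z) auto
  obtain a0 b0 where 0: "z0 = emb a0 * x 0 + emb b0 * y 0" using indep_span[OF i(1)] .
  obtain a1 b1 where 1: "z1 = emb a1 * x 1 + emb b1 * y 1" using indep_span[OF i(2)] .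
  define A where "A i = (if i = 0 then a0 else if i = Suc 0 then a1 else 0)" for i
  define B where "B i = (if i = 0 then b0 else if i = Suc 0 then b1 else 0)" for i
  \<comment> \<open>Entry 0 of a group does not enter \<open>block_point\<close>, so it is free to
    adjust the block sum.\<close>
  define c where "c = block_vec m (\<lambda>i j. if j = 0 then w $ i - A i - B i
    else if j = 1 then A i else B i)"
  have block_sum: "block_sum c i = w $ i" if "i < m" for i
    using that by (simp add: block_sum_def c_def block_vec_index)
  have block_point: "block_point x y c i = emb (A i) * x i + emb (B i) * y i" if "i < m" for i
    using that by (simp add: block_point_def c_def block_vec_index)
  have "point_sum m d x y c = (\<Sum>i\<in>{0, 1}. scl (block_point x y c i) (d i))"
    unfolding point_sum_def
    by (rule sum.mono_neutral_right) (use m in \<open>auto simp: block_point A_def B_def\<close>)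
  also have "\<dots> = v" using m by (simp add: block_point A_def B_def z 0 1)
  finally have "parity_check m d x y c = w"
    using w v by (intro eq_vecI) (auto simp: parity_check_def block_sum)
  then show ?thesis using block_vec_carrier unfolding c_def by blast
qed

text \<open>The code is the kernel of a surjection from dimension \<open>3 * m\<close> onto
  dimension \<open>m + 4\<close>.\<close>

lemma linear_code_line_code:
  fixes d :: "nat \<Rightarrow> 'a::{field,finite} quad \<times> 'a quad"
  assumes arr: "arrangement m d x y" and m: "m \<ge> 2"
  shows "linear_code (3 * m) (2 * m - 4) (line_code m d x y)"
proof -
  let ?V = "module_vec TYPE('a) (3 * m)" and ?W = "module_vec TYPE('a) (m + 4)"
  let ?T = "parity_check m d x y"
  interpret V: vec_space "TYPE('a)" "3 * m" .
  interpret W: vec_space "TYPE('a)" "m + 4" .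
  have hom: "?T \<in> module_hom class_ring ?V ?W"
    unfolding module_hom_def
    by (auto simp: module_vec_simps class_ring_simps parity_check_def block_sum_add block_sum_smult
      point_sum_add point_sum_smult
        coord_add coord_scl_emb)
  interpret L: linear_map class_ring ?V ?W ?T
    by (intro linear_map.intro vec_vs mod_hom.intro vec_module mod_hom_axioms.intro hom)
  have ker: "L.ker = line_code m d x y"
    unfolding L.ker_def line_code_def by (auto simp: module_vec_simps parity_check_eq_0_iff)
  have im: "L.im = carrier_vec (m + 4)"
  proof
    show "L.im \<subseteq> carrier_vec (m + 4)"
      unfolding L.im_def by (auto simp: parity_check_def)
    show "carrier_vec (m + 4) \<subseteq> L.im"
      using parity_check_surj[OF arr m] unfolding L.im_def by (force simp: module_vec_simps)
  qed
  have "VectorSpace.subspace class_ring (line_code m d x y) ?V"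
    using L.kerT_is_subspace unfolding ker .
  moreover have "vectorspace.dim class_ring (?V\<lparr>carrier := line_code m d x y\<rparr>) = 2 * m - 4"
  proof -
    have W: "?W\<lparr>carrier := carrier_vec (m + 4)\<rparr> = ?W" by (simp add: module_vec_def)
    have "vectorspace.dim class_ring ?W
        + vectorspace.dim class_ring (?V\<lparr>carrier := line_code m d x y\<rparr>) = V.dim"
      using L.rank_nullity[OF V.fin_dim] unfolding ker im W .
    then show ?thesis using V.dim_is_n W.dim_is_n by simp
  qed
  ultimately show ?thesis unfolding linear_code_def by blast
qed

section \<open>Distance and repair groups\<close>

definition block_weight :: "'a::zero vec \<Rightarrow> nat \<Rightarrow> nat" where
  "block_weight c i =
    of_bool (c $ (3 * i) \<noteq> 0) + of_bool (c $ (3 * i + 1) \<noteq> 0) + of_bool (c $ (3 * i + 2) \<noteq> 0)"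

lemma hamming_weight_blocks:
  assumes "c \<in> carrier_vec (3 * m)"
  shows "hamming_weight c = (\<Sum>i<m. block_weight c i)"
proof -
  have "hamming_weight c = (\<Sum>t<3 * m. of_bool (c $ t \<noteq> 0))"
    using assms by (simp add: hamming_weight_def supp_def sum.If_cases of_bool_def Int_def)
  then show ?thesis unfolding sum_triple block_weight_def by simp
qed

lemma hamming_weight_le:
  assumes "c \<in> carrier_vec n" shows "hamming_weight c \<le> n"
proof -
  have "card (supp c) \<le> card {..<n}"
    using assms by (intro card_mono) (auto simp: supp_def)
  then show ?thesis by (simp add: hamming_weight_def)
qed

lemma block_point_eq_0:
  assumes "indep (x i) (y i)" "block_sum c i = 0" "block_point x y c i = 0"
  shows "block_weight c i = 0"
proof -
  have "c $ (3 * i + 1) = 0 \<and> c $ (3 * i + 2) = 0"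
    using assms unfolding indep_def block_point_def by blast
  with assms(2) show ?thesis by (simp add: block_sum_def block_weight_def)
qed

lemma block_weight_ge_2:
  assumes "block_sum c i = 0" "block_weight c i \<noteq> 0"
  shows "block_weight c i \<ge> 2"
  using assms unfolding block_sum_def block_weight_def by (auto simp: of_bool_def split: if_splits)

text \<open>Exactly one entry of the group vanishes. If it is entry 0, 1 or 2, the point is a
  multiple of \<open>x i - y i\<close>, \<open>y i\<close> or \<open>x i\<close>
  respectively.\<close>

lemma block_weight_2_special_pts:
  assumes "block_sum c i = 0" "block_weight c i = 2"
  shows "block_point x y c i \<in> special_pts (x i) (y i)"
proof -
  let ?a = "c $ (3 * i)" and ?b = "c $ (3 * i + 1)" and ?e = "c $ (3 * i + 2)"
  consider "?a = 0" "?b \<noteq> 0" "?e = - ?b" | "?b = 0" "?e \<noteq> 0" | "?e = 0" "?b \<noteq> 0"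
    using assms unfolding block_sum_def block_weight_def
    by (cases "?a = 0"; cases "?b = 0"; cases "?e = 0") (auto simp: add_eq_0_iff)
  then show ?thesis
  proof cases
    case 1
    have "block_point x y c i = emb ?b * (x i - y i)" unfolding block_point_def 1(3)
      by (simp add: right_diff_distrib)
    then show ?thesis using special_pts_mult[OF special_pts_base(3) 1(2)] by simp
  next
    case 2
    then show ?thesis using special_pts_mult[OF special_pts_base(2) 2(2)]
      by (simp add: block_point_def)
  next
    case 3
    then show ?thesis using special_pts_mult[OF special_pts_base(1) 3(2)]
      by (simp add: block_point_def)
  qed
qed

lemma card_3_ordered:
  fixes I :: "nat set"
  assumes "card I = 3"
  obtains i j k where "i < j" "j < k" "I = {i, j, k}"
proof -
  obtain i j k where I: "I = {i, j, k}" "i \<noteq> j" "j \<noteq> k" "i \<noteq> k"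
    using assms unfolding card_3_iff by blast
  then have "\<exists>i j k. i < j \<and> j < k \<and> I = {i, j, k}"
    by (metis insert_commute linorder_neqE_nat)
  with that show thesis by blast
qed

text \<open>A nonzero block of a codeword contributes weight at least 2 and a nonzero vector on the
  corresponding line; weight exactly 2 means that this vector is on a special point.\<close>

lemma line_code_weight_ge_7:
  assumes arr: "arrangement m d x y" and c: "c \<in> line_code m d x y" "c \<noteq> 0\<^sub>v (3 * m)"
  shows "hamming_weight c \<ge> 7"
proof (rule ccontr)
  assume "\<not> hamming_weight c \<ge> 7"
  then have w: "hamming_weight c \<le> 6" by simp
  let ?z = "block_point x y c"
  define I where "I = {i. i < m \<and> ?z i \<noteq> 0}"
  have cc: "c \<in> carrier_vec (3 * m)" and block_sum: "\<And>i. i < m \<Longrightarrow> block_sum c i = 0"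
    and point_sum: "point_sum m d x y c = 0" using c unfolding line_code_def by auto
  have dirs: "d i \<in> dirs" "indep (x i) (y i)" if "i < m" for i
    using arr that unfolding arrangement_def by auto
  have inj: "inj_on d {..<m}" using arr unfolding arrangement_def by auto
  have Im: "i < m" "?z i \<noteq> 0" if "i \<in> I" for i using that unfolding I_def by auto
  have finI: "finite I" unfolding I_def by simp
  have two: "block_weight c i \<ge> 2" if "i \<in> I" for i
  proof (rule block_weight_ge_2)
    show "block_weight c i \<noteq> 0"
    proof
      assume *: "block_weight c i = 0"
      then have "?z i = 0" by (simp add: block_weight_def block_point_def)
      then show False using Im[OF that] by simp
    qed
  qed (rule block_sum[OF Im(1)[OF that]])
  have sumI: "(\<Sum>i\<in>I. block_weight c i) \<le> 6"
  proof -
    have "(\<Sum>i\<in>I. block_weight c i) \<le> (\<Sum>i<m. block_weight c i)"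
      by (rule sum_mono2) (auto simp: I_def)
    then show ?thesis using w hamming_weight_blocks[OF cc] by simp
  qed
  have synI: "(\<Sum>i\<in>I. scl (?z i) (d i)) = 0"
  proof -
    have "(\<Sum>i<m. scl (?z i) (d i)) = (\<Sum>i\<in>I. scl (?z i) (d i))"
      by (rule sum.mono_neutral_right) (auto simp: I_def)
    then show ?thesis using point_sum by (simp add: point_sum_def)
  qed
  \<comment> \<open>At most three groups are active. With none the word is zero, one or two
    contradict the independence of spread lines, and three must all have weight 2, giving a
    forbidden collinear triple of special points.\<close>
  have "2 * card I \<le> 6"
    using sum_mono[of I "\<lambda>_. 2" "block_weight c"] two sumI by simp
  then consider "card I = 0" | "card I = 1" | "card I = 2" | "card I = 3" by linarith
  then show False
  proof cases
    case 1
    then have "\<And>i. i < m \<Longrightarrow> ?z i = 0" using finI I_def by auto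
    then have "\<And>i. i < m \<Longrightarrow> block_weight c i = 0" using block_point_eq_0 dirs block_sum by blast
    then have "hamming_weight c = 0" using hamming_weight_blocks[OF cc] by simp
    then have "supp c = {}" by (simp add: hamming_weight_def supp_def)
    then have "c = 0\<^sub>v (3 * m)" using cc by (intro eq_vecI) (auto simp: supp_def)
    then show False using c by simp
  next
    case 2
    then obtain i where "I = {i}" by (auto simp: card_1_singleton_iff)
    then show False using synI Im[of i] scl_eq_0_iff[OF dirs(1), of i "?z i"] by simp
  next
    case 3
    then obtain i j where I: "I = {i, j}" "i \<noteq> j" by (auto simp: card_2_iff)
    then have "d i \<noteq> d j" using inj Im[of i] Im[of j] by (auto simp: inj_on_def)
    moreover have "scl (?z i) (d i) + scl (?z j) (d j) = 0" using synI I by simp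
    ultimately show False using dirs_indep Im[of i] Im[of j] dirs I by blast
  next
    case 4
    then obtain i j k where I: "i < j" "j < k" "I = {i, j, k}" by (rule card_3_ordered)
    then have "block_weight c i + (block_weight c j + block_weight c k) \<le> 6" using sumI by simp
    with two[of i] two[of j] two[of k] I(3)
    have "block_weight c i = 2" "block_weight c j = 2" "block_weight c k = 2" by auto
    moreover have "?z t \<in> special_pts (x t) (y t)" if "t \<in> I" "block_weight c t = 2" for t
      using that by (intro block_weight_2_special_pts block_sum Im(1))
    ultimately have "?z i \<in> special_pts (x i) (y i)" "?z j \<in> special_pts (x j) (y j)"
      "?z k \<in> special_pts (x k) (y k)"
      using I(3) by auto
    moreover have "scl (?z i) (d i) + scl (?z j) (d j) + scl (?z k) (d k) = 0"
      using synI I by (simp add: add.assoc)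
    moreover have "k < m" using Im(1) I(3) by simp
    ultimately show False using arr I(1,2) unfolding arrangement_def by blast
  qed
qed

text \<open>Converse to \<open>block_weight_2_special_pts\<close>: the group entries
  \<open>- (a + b)\<close>, \<open>a\<close>, \<open>b\<close> sum to zero, represent
  \<open>p\<close>, and at least one of them vanishes.\<close>

lemma special_pts_block:
  assumes "p \<in> special_pts u v"
  obtains a b where "p = emb a * u + emb b * v" "a = 0 \<or> b = 0 \<or> a + b = 0"
proof -
  from assms obtain s where "p = emb s * u \<or> p = emb s * v \<or> p = emb s * (u - v)"
    unfolding special_pts_def ray_def by blast
  then have "p = emb s * u + emb 0 * v \<or> p = emb 0 * u + emb s * v \<or> p = emb s * u + emb (- s) * v"
    by (simp add: right_diff_distrib)
  then show thesis using that[of s 0] that[of 0 s] that[of s "- s"] by auto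
qed

text \<open>The transversal yields a codeword on the first three groups of weight at most
  \<open>2 + 2 + 3\<close>. It is nonzero because \<open>p\<close> is, so the lower bound gives
  equality.\<close>

lemma exists_weight_7:
  assumes arr: "arrangement m d x y" and m: "m \<ge> 3" and tr: "has_transversal d x y"
  shows "\<exists>c \<in> line_code m d x y. hamming_weight c = 7"
proof -
  obtain p q r where p: "p \<in> special_pts (x 0) (y 0)" and q: "q \<in> special_pts (x 1) (y 1)"
    and pqr: "scl p (d 0) + scl q (d 1) + scl r (d 2) = 0"
    using tr unfolding has_transversal_def by blast
  have i: "indep (x 0) (y 0)" "indep (x 2) (y 2)"
    using arr m unfolding arrangement_def by auto
  obtain a0 b0 where 0: "p = emb a0 * x 0 + emb b0 * y 0" "a0 = 0 \<or> b0 = 0 \<or> a0 + b0 = 0"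
    using special_pts_block[OF p] .
  obtain a1 b1 where 1: "q = emb a1 * x 1 + emb b1 * y 1" "a1 = 0 \<or> b1 = 0 \<or> a1 + b1 = 0"
    using special_pts_block[OF q] .
  obtain a2 b2 where 2: "r = emb a2 * x 2 + emb b2 * y 2" using indep_span[OF i(2)] .
  define A where "A i = (if i = 0 then a0 else if i = Suc 0 then a1
    else if i = 2 then a2 else 0)" for i
  define B where "B i = (if i = 0 then b0 else if i = Suc 0 then b1
    else if i = 2 then b2 else 0)" for i
  define c where "c = block_vec m (\<lambda>i j. if j = 0 then - (A i + B i)
    else if j = 1 then A i else B i)"
  have cc: "c \<in> carrier_vec (3 * m)" unfolding c_def by (rule block_vec_carrier)
  have block_sum: "block_sum c i = 0" if "i < m" for i
    using that by (simp add: block_sum_def c_def block_vec_index)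
  have block_point: "block_point x y c i = emb (A i) * x i + emb (B i) * y i" if "i < m" for i
    using that by (simp add: block_point_def c_def block_vec_index)
  have bw: "block_weight c i = of_bool (A i + B i \<noteq> 0) + of_bool (A i \<noteq> 0) + of_bool (B i \<noteq> 0)"
    if "i < m" for i
    using that by (simp add: block_weight_def c_def block_vec_index neg_eq_iff_add_eq_0)
  have "point_sum m d x y c = (\<Sum>i\<in>{0, 1, 2}. scl (block_point x y c i) (d i))"
    unfolding point_sum_def
    by (rule sum.mono_neutral_right) (use m in \<open>auto simp: block_point A_def B_def\<close>)
  also have "\<dots> = 0" using m pqr by (simp add: block_point A_def B_def 0 1 2 add.assoc)
  finally have line_code: "c \<in> line_code m d x y" using cc block_sum unfolding line_code_def by simp
  have "hamming_weight c = (\<Sum>i\<in>{0, 1, 2}. block_weight c i)"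
    unfolding hamming_weight_blocks[OF cc]
    by (rule sum.mono_neutral_right) (use m in \<open>auto simp: bw A_def B_def\<close>)
  also have "\<dots> = block_weight c 0 + block_weight c 1 + block_weight c 2" by simp
  also have "\<dots> \<le> 2 + 2 + 3"
  proof (intro add_mono)
    show "block_weight c 0 \<le> 2" using m 0(2) by (auto simp: bw A_def B_def)
    show "block_weight c 1 \<le> 2" using m 1(2) by (auto simp: bw A_def B_def)
    show "block_weight c 2 \<le> 3" using m by (simp add: bw)
  qed
  finally have "hamming_weight c \<le> 7" by simp
  moreover have "c \<noteq> 0\<^sub>v (3 * m)"
  proof
    assume "c = 0\<^sub>v (3 * m)"
    then have "block_point x y c 0 = 0" using m by (simp add: block_point_def)
    then have "p = 0" using block_point[of 0] m by (simp add: A_def B_def 0(1))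
    then show False using p special_pts_nonzero[OF i(1)] by simp
  qed
  ultimately show ?thesis using line_code_weight_ge_7[OF arr line_code] line_code by force
qed

lemma line_code_diff: "c \<in> line_code m d x y \<Longrightarrow> c' \<in> line_code m d x y \<Longrightarrow> c - c' \<in> line_code m d x y"
proof -
  assume *: "c \<in> line_code m d x y" "c' \<in> line_code m d x y"
  then have cc: "c \<in> carrier_vec (3 * m)" "(- 1) \<cdot>\<^sub>v c' \<in> carrier_vec (3 * m)"
    "c' \<in> carrier_vec (3 * m)" unfolding line_code_def by auto
  have e: "c - c' = c + (- 1) \<cdot>\<^sub>v c'" using cc by (intro eq_vecI) auto
  have "block_sum (c - c') i = 0" if "i < m" for i
    unfolding e using * that cc
      by (simp add: block_sum_add block_sum_smult line_code_def del: carrier_vec_dim_vec)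
  moreover have "point_sum m d x y (c - c') = 0"
    unfolding e using * by (simp only: point_sum_add[OF cc(1,2)] point_sum_smult[OF cc(3)])
      (simp add: line_code_def scl_def zero_prod_def)
  ultimately show ?thesis using cc unfolding line_code_def by auto
qed

lemma hamming_dist_diff:
  fixes u v :: "'a::ab_group_add vec"
  assumes "u \<in> carrier_vec n" "v \<in> carrier_vec n"
  shows "hamming_dist u v = hamming_weight (u - v)"
  unfolding hamming_dist_def hamming_weight_def supp_def
  using assms by (auto intro!: arg_cong[where f = card])

lemma line_code_carrier: "c \<in> line_code m d x y \<Longrightarrow> c \<in> carrier_vec (3 * m)"
  by (simp add: line_code_def)

lemma line_code_zero: "0\<^sub>v (3 * m) \<in> line_code m d x y"
  by (auto simp: line_code_def block_sum_def point_sum_def block_point_def)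

text \<open>By linearity, distances are weights of nonzero codewords. For \<open>m = 2\<close> the
  length 6 leaves no room for weight 7, so the code is zero and the convention gives
  \<open>6 + 1\<close>.\<close>

lemma min_distance_line_code:
  assumes arr: "arrangement m d x y"
    and m: "m = 2 \<or> m \<ge> 3 \<and> has_transversal d x y"
  shows "min_distance (3 * m) (line_code m d x y) = 7"
proof (cases "m = 2")
  case True
  have "c = 0\<^sub>v (3 * m)" if "c \<in> line_code m d x y" for c
  proof (rule ccontr)
    assume "c \<noteq> 0\<^sub>v (3 * m)"
    from line_code_weight_ge_7[OF arr that this]
      hamming_weight_le[OF line_code_carrier[OF that]] True
    show False by simp
  qed
  then have "line_code m d x y = {0\<^sub>v (3 * m)}" using line_code_zero by blast
  then show ?thesis using True by (simp add: min_distance_def)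
next
  case False
  let ?C = "line_code m d x y"
  let ?D = "{hamming_dist u v | u v. u \<in> ?C \<and> v \<in> ?C \<and> u \<noteq> v}"
  obtain c where c: "c \<in> ?C" "hamming_weight c = 7"
    using exists_weight_7[OF arr] m False by blast
  have c0: "c \<noteq> 0\<^sub>v (3 * m)"
  proof
    assume "c = 0\<^sub>v (3 * m)"
    then have "supp c = {}" by (simp add: supp_def)
    then show False using c(2) by (simp add: hamming_weight_def)
  qed
  have dist: "hamming_dist u v = hamming_weight (u - v)" if "u \<in> ?C" "v \<in> ?C" for u v
    using hamming_dist_diff[OF line_code_carrier line_code_carrier] that by blast
  have "Min ?D = 7"
  proof (rule Min_eqI)
    have "hamming_dist u v \<le> 3 * m" if "u \<in> ?C" "v \<in> ?C" for u v
      unfolding dist[OF that]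
        by (rule hamming_weight_le[OF line_code_carrier[OF line_code_diff[OF that]]])
    then have "?D \<subseteq> {..3 * m}" by blast
    then show "finite ?D" by (rule finite_subset) simp
    have "c - 0\<^sub>v (3 * m) = c" using line_code_carrier[OF c(1)] by auto
    then have "hamming_dist c (0\<^sub>v (3 * m)) = 7" using dist[OF c(1) line_code_zero] c(2) by simp
    then show "7 \<in> ?D" using c(1) c0 line_code_zero[of m d x y]
      by (intro CollectI exI[of _ c] exI[of _ "0\<^sub>v (3 * m)"]) simp
    fix t assume "t \<in> ?D"
    then obtain u v where uv: "u \<in> ?C" "v \<in> ?C" "u \<noteq> v" "t = hamming_dist u v" by blast
    have "u - v \<noteq> 0\<^sub>v (3 * m)"
    proof
      assume *: "u - v = 0\<^sub>v (3 * m)"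
      have "u = v"
      proof (rule eq_vecI)
        fix i assume "i < dim_vec v"
        then show "u $ i = v $ i"
          using arg_cong[OF *, of "\<lambda>w. w $ i"] line_code_carrier[OF uv(2)] by auto
      qed (use carrier_vecD[OF line_code_carrier] uv in metis)
      then show False using uv by simp
    qed
    then show "7 \<le> t"
      using line_code_weight_ge_7[OF arr line_code_diff[OF uv(1,2)]] uv(4) dist[OF uv(1,2)] by simp
  qed
  moreover have "?C \<noteq> {0\<^sub>v (3 * m)}" using c(1) c0 by blast
  ultimately show ?thesis unfolding min_distance_def by simp
qed

section \<open>Local checks: locality and disjoint repair groups\<close>

text \<open>The row of the parity check matrix that computes \<open>block_sum\<close>.\<close>

definition block_check :: "nat \<Rightarrow> nat \<Rightarrow> 'a::field vec" where
  "block_check m i = block_vec m (\<lambda>i' j. of_bool (i' = i))"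

lemma block_check_dual:
  assumes "i < m"
  shows "block_check m i \<in> dual_code (3 * m) (line_code m d x y)"
proof -
  have "block_check m i \<bullet> c = 0" if "c \<in> line_code m d x y" for c
  proof -
    have "block_check m i \<bullet> c = (\<Sum>t<3 * m. block_check m i $ t * c $ t)"
      using line_code_carrier[OF that] by (simp add: scalar_prod_def atLeast0LessThan)
    also have "\<dots> = (\<Sum>j<m. if j = i then block_sum c j else 0)"
      unfolding sum_triple
      by (intro sum.cong refl) (auto simp: block_check_def block_vec_index block_sum_def)
    also have "\<dots> = 0" using that assms by (simp add: line_code_def)
    finally show ?thesis .
  qed
  then show ?thesis by (simp add: dual_code_def block_check_def block_vec_carrier)
qed

lemma supp_block_check:
  assumes "i < m"
  shows "supp (block_check m i :: 'a::field vec) = {t. t div 3 = i}"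
  using assms by (auto simp: supp_def block_check_def block_vec_def)

lemma weight_block_check:
  assumes "i < m"
  shows "hamming_weight (block_check m i :: 'a::field vec) = 3"
proof -
  have "{t. t div 3 = i} = {3 * i, 3 * i + 1, 3 * i + 2}" by auto
  then show ?thesis unfolding hamming_weight_def supp_block_check[OF assms] by simp
qed

lemma has_locality_line_code: "has_locality (3 * m) 2 (line_code m d x y)"
  unfolding has_locality_def
proof (intro allI impI)
  fix t assume "t < 3 * m"
  then have i: "t div 3 < m" by linarith
  then show "\<exists>h\<in>dual_code (3 * m) (line_code m d x y). t \<in> supp h \<and> hamming_weight h \<le> 2 + 1"
    by (intro bexI[OF _ block_check_dual[OF i]]) (simp add: supp_block_check weight_block_check)
qed

lemma disjoint_repair_groups_line_code:
  fixes d :: "nat \<Rightarrow> 'a::{field,finite} quad \<times> 'a quad"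
  shows "disjoint_repair_groups (3 * m) 2 (line_code m d x y)"
  unfolding disjoint_repair_groups_def
proof (intro conjI exI)
  let ?H = "block_check m ` {..<m} :: 'a vec set"
  show "2 + 1 dvd 3 * m" by simp
  show "?H \<subseteq> dual_code (3 * m) (line_code m d x y)" using block_check_dual by blast
  show "finite ?H" by simp
  have "inj_on (block_check m :: nat \<Rightarrow> 'a vec) {..<m}"
  proof (rule inj_onI)
    fix i j assume *: "i \<in> {..<m}" "j \<in> {..<m}" "block_check m i = (block_check m j :: 'a vec)"
    then have "{t. t div 3 = i} = {t. t div 3 = j}"
      using supp_block_check[of i m, where 'a = 'a] supp_block_check[of j m, where 'a = 'a] by simp
    moreover have "3 * i \<in> {t. t div 3 = i}" by simp
    ultimately show "i = j" by auto
  qed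
  then show "card ?H = 3 * m div (2 + 1)" by (simp add: card_image)
  show "\<forall>h\<in>?H. hamming_weight h = 2 + 1" by (simp add: weight_block_check)
  show "disjoint_family_on supp ?H"
    unfolding disjoint_family_on_def by (auto simp: supp_block_check)
qed

section \<open>The length formula and the final assembly\<close>

text \<open>The fraction is the positive root of
  \<open>9 k\<^sup>2 - 7 k - 2 (q\<^sup>2 + 1) = 0\<close>, so below it the greedy step
  succeeds.\<close>

lemma greedy_step_bound:
  assumes "\<not> (7 + sqrt (72 * (real q)\<^sup>2 + 121)) / 18 \<le> real k"
  shows "9 * (k * (k - 1)) + 2 * k < 2 * (q\<^sup>2 + 1)"
proof (cases k)
  case (Suc j)
  have "18 * real k - 7 < sqrt (72 * (real q)\<^sup>2 + 121)" using assms by simp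
  \<comment> \<open>Squaring needs a nonnegative left side, which is why \<open>k = 0\<close> is
    split off.\<close>
  moreover have "0 \<le> 18 * real k - 7" using Suc by simp
  ultimately have "(18 * real k - 7)\<^sup>2 < (sqrt (72 * (real q)\<^sup>2 + 121))\<^sup>2"
    by (intro power_strict_mono) auto
  then have "(18 * real k - 7)\<^sup>2 < 72 * (real q)\<^sup>2 + 121" by simp
  then have "9 * (real k * (real k - 1)) + 2 * real k < 2 * ((real q)\<^sup>2 + 1)"
    by (simp add: power2_eq_square algebra_simps)
  then have "real (9 * (k * (k - 1)) + 2 * k) < real (2 * (q\<^sup>2 + 1))"
    using Suc by (simp add: algebra_simps)
  then show ?thesis by (simp only: of_nat_less_iff)
qed simp

theorem theorem10:
  fixes q n :: nat
  assumes "primepow q" and "q \<ge> 3"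
    and "card (UNIV :: 'a::{field,finite} set) = q"
    and "int n = 3 * \<lceil>(7 + sqrt (72 * (real q)\<^sup>2 + 121)) / 18\<rceil>"
  shows "\<exists>(C :: 'a vec set) k.
           linear_code n k C \<and>
           min_distance n C = 7 \<and>
           has_locality n 2 C \<and>
           disjoint_repair_groups n 2 C \<and>
           singleton_optimal n k 7 2"
proof -
  define X where "X = (7 + sqrt (72 * (real q)\<^sup>2 + 121)) / 18"
  define m where "m = nat \<lceil>X\<rceil>"
  have q: "q = card (UNIV :: 'a set)" using assms(3) by simp
  have q9: "(real q)\<^sup>2 \<ge> 3\<^sup>2" using assms(2) by (intro power_mono) auto
  \<comment> \<open>\<open>72 * 9 + 121 = 769 > 27\<^sup>2\<close>, whence
    \<open>X > 34 / 18\<close>.\<close>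
  have "sqrt (27\<^sup>2) < sqrt (72 * (real q)\<^sup>2 + 121)" using q9 by (intro real_sqrt_less_mono) simp
  then have X1: "X > 1" by (simp add: X_def)
  have m_int: "int m = \<lceil>X\<rceil>" using X1 unfolding m_def by simp
  have n: "n = 3 * m" using assms(4) m_int unfolding X_def by simp
  have m2: "m \<ge> 2" using X1 m_int by linarith
  have step: "9 * (k * (k - 1)) + 2 * k < 2 * (q\<^sup>2 + 1)" if "k < m" for k
  proof (rule greedy_step_bound)
    show "\<not> (7 + sqrt (72 * (real q)\<^sup>2 + 121)) / 18 \<le> real k"
      unfolding X_def[symmetric] using that m_int by linarith
  qed
  obtain d x and y :: "nat \<Rightarrow> 'a quad" where arr: "arrangement m d x y"
    and tr: "m = 2 \<or> m \<ge> 3 \<and> has_transversal d x y"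
  proof (cases "q = 3")
    case True
    \<comment> \<open>For \<open>q = 3\<close> the radicand 769 is below
      \<open>28\<^sup>2 = 784\<close>, so \<open>X \<le> 35 / 18\<close> and
      \<open>m = 2\<close>.\<close>
    have "sqrt (72 * (real q)\<^sup>2 + 121) \<le> sqrt (28\<^sup>2)"
      unfolding True by (intro real_sqrt_le_mono) simp
    then have "X \<le> 2" by (simp add: X_def)
    then have "m = 2" using m_int m2 by linarith
    with exists_arrangement[OF q step] that show thesis by blast
  next
    case False
    then have q4: "q \<ge> 4" using assms(2) by simp
    then have "(real q)\<^sup>2 \<ge> 4\<^sup>2" by (intro power_mono) auto
    \<comment> \<open>\<open>72 * 16 + 121 = 1273 > 35\<^sup>2\<close>, so
      \<open>X > 42 / 18\<close> and there are at least three lines.\<close>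
    then have "sqrt (35\<^sup>2) < sqrt (72 * (real q)\<^sup>2 + 121)" by (intro real_sqrt_less_mono) simp
    then have "X > 2" by (simp add: X_def)
    then have "m \<ge> 3" using m_int by linarith
    with exists_arrangement_with_transversal[OF q q4 _ step] that show thesis by blast
  qed
  \<comment> \<open>Both sides equal \<open>m + 4\<close>: \<open>3 * m - (2 * m - 4)\<close> on the
    left, \<open>m + 7 - 2 - 1\<close> on the right.\<close>
  have "singleton_optimal n (2 * m - 4) 7 2"
    using m2 unfolding singleton_optimal_def n by (simp add: of_nat_diff)
  then show ?thesis
    using linear_code_line_code[OF arr m2] min_distance_line_code[OF arr tr] has_locality_line_code
      disjoint_repair_groups_line_code unfolding n by blast
qed

end
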